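(* Let $2\le k\le n-2$, let $v_1,\dots,v_{\binom nk}$ be the vertices of $\Delta(k,n)$ in descending lexicographic order, and let $\kappa=\kappa_{k,n}$ be the lifting function with $\kappa(v_i)=1$ for $1\le i\le\binom{n-1}{k-1}-1$ and $\kappa(v_i)=0$ otherwise. The regular subdivision $\Delta(k,n)^\kappa$ is a non-matroidal coarsest subdivision of spread $n$. Out of the $n$ maximal cells, $k$ are pyramids of lattice height one over $\Delta(k,n-1)$, and the remaining $n-k$ are pyramids over $\Delta(k-1,n-1)$.
   Context: The hypersimplex $\Delta(k,n)=\operatorname{conv}\{e_X : X\subseteq[n],\ |X|=k\}\subset\mathbb{R}^n$ with $e_X=\sum_{i\in X}e_i$; vertices are ordered in descending lexicographic order as 0/1-vectors (e.g., for $\Delta(2,4)$: $1100,1010,1001,0110,0101,0011$). A lifting function $\omega$ induces the regular subdivision $\Delta(k,n)^\omega$, whose cells are the projections (omitting the last coordinate) of the lower faces of $\operatorname{conv}\{(v,\omega(v))\}$, i.e., faces with an outer normal having negative last coordinate. The spread is the number of maximal cells. A regular subdivision is coarsest if its secondary cone (the closure of the set of lifting functions inducing it) is a ray modulo the lineality space of the secondary fan; equivalently it is nontrivial and the only regular subdivisions it refines are itself and the trivial one. Non-matroidal means that $\kappa$ does not lie in the Dressian $\mathrm{Dr}(k,n)$, i.e., the vertex-edge graph of $\Delta(k,n)^\kappa$ differs from that of $\Delta(k,n)$ (equivalently, some cell is not a matroid polytope, i.e., has an edge not parallel to any $e_i-e_j$). A pyramid of lattice height one over a lattice polytope $Q$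 is the convex hull of (a lattice-isomorphic copy of) $Q$ and an apex at lattice distance one from the affine hull of $Q$.
   Formalization: "Coarsest" is claimed only for (k,n) ≠ (2,4): for (2,4), κ triangulates the octahedron into four tetrahedra, which properly refines a split into two square pyramids, so it is not coarsest. All other claims are kept for (2,4). *)

theory Defs
  imports "HOL-Analysis.Analysis" "HOL-Library.Fun_Lexorder"
begin

text \<open>
  The ambient space of \<open>\<Delta>(k,n)\<close> is \<open>real ^ 'n\<close> with \<open>n = CARD('n)\<close>; where the order of the
  coordinates matters, \<open>'n\<close> is linearly ordered and plays the role of \<open>[n]\<close>.
\<close>

definition hypersimplex_vertices :: "nat \<Rightarrow> (real ^ 'n) set" where
  "hypersimplex_vertices k = {\<Sum>i\<in>X. axis i 1 | X. card X = k}"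

definition hypersimplex :: "nat \<Rightarrow> (real ^ 'n) set" where
  "hypersimplex k = convex hull (hypersimplex_vertices k)"

definition lex_less :: "(real ^ 'n::{finite,linorder}) \<Rightarrow> (real ^ 'n::{finite,linorder}) \<Rightarrow> bool" where
  "lex_less x y \<longleftrightarrow> less_fun (($) x) (($) y)"


definition lifted_polytope :: "'a::real_vector set \<Rightarrow> ('a \<Rightarrow> real) \<Rightarrow> ('a \<times> real) set" where
  "lifted_polytope V \<omega> = convex hull ((\<lambda>v. (v, \<omega> v)) ` V)"

definition lower_face :: "('a::euclidean_space \<times> real) set \<Rightarrow> ('a \<times> real) set \<Rightarrow> bool" where
  "lower_face F P \<longleftrightarrow>
     (\<exists>a b. b < 0 \<and> F = {p \<in> P. \<forall>q\<in>P. (a, b) \<bullet> q \<le> (a, b) \<bullet> p})"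

text \<open>
  All cells, of every dimension. A subdivision is recorded as a set of polytopes, without
  marking the points of \<open>V\<close> used by each cell; this loses nothing when, as for hypersimplices,
  every point of \<open>V\<close> is a vertex of the convex hull of \<open>V\<close>.
\<close>

definition regular_subdivision :: "'a::euclidean_space set \<Rightarrow> ('a \<Rightarrow> real) \<Rightarrow> 'a set set" where
  "regular_subdivision V \<omega> = {fst ` F | F. lower_face F (lifted_polytope V \<omega>)}"

definition maximal_cells :: "'a set set \<Rightarrow> 'a set set" where
  "maximal_cells S = {C \<in> S. \<forall>D\<in>S. C \<subseteq> D \<longrightarrow> D = C}"

definition spread :: "'a set set \<Rightarrow> nat" where
  "spread S = card (maximal_cells S)"


text \<open>
  Lifting functions are total functions, with pointwise vector operations and the topology of
  pointwise convergence. Their values outside \<open>V\<close> influence nothing: functions vanishing on \<open>V\<close>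
  belong to the lineality space, so the quotient by the lineality space is the one obtained
  from functions on \<open>V\<close> alone.
\<close>

definition secondary_cone :: "'a::euclidean_space set \<Rightarrow> 'a set set \<Rightarrow> ('a \<Rightarrow> real) set" where
  "secondary_cone V S = closure {\<omega>. regular_subdivision V \<omega> = S}"

definition secondary_fan :: "'a::euclidean_space set \<Rightarrow> ('a \<Rightarrow> real) set set" where
  "secondary_fan V = {secondary_cone V (regular_subdivision V \<omega>) | \<omega>. True}"

definition secondary_lineality :: "'a::euclidean_space set \<Rightarrow> ('a \<Rightarrow> real) set" where
  "secondary_lineality V = {l. \<forall>C\<in>secondary_fan V. l \<in> C \<and> (\<lambda>x. - l x) \<in> C}"

definition coarsest_subdivision :: "'a::euclidean_space set \<Rightarrow> 'a set set \<Rightarrow> bool" where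
  "coarsest_subdivision V S \<longleftrightarrow>
     (\<exists>\<rho>. \<rho> \<notin> secondary_lineality V \<and>
        secondary_cone V S =
          {\<lambda>x. c * \<rho> x + l x | c l. 0 \<le> c \<and> l \<in> secondary_lineality V})"


text \<open>Graphs are compared geometrically: edges are segments, vertices are singletons.\<close>

definition vertex_edge_graph :: "'a::euclidean_space set set \<Rightarrow> 'a set set \<times> 'a set set" where
  "vertex_edge_graph S = ({F \<in> S. aff_dim F = 0}, {F \<in> S. aff_dim F = 1})"

definition Dressian :: "nat \<Rightarrow> (real ^ 'n \<Rightarrow> real) set" where
  "Dressian k = {\<omega>. vertex_edge_graph (regular_subdivision (hypersimplex_vertices k) \<omega>) =
                     vertex_edge_graph {F. F face_of hypersimplex k}}"


definition integer_lattice :: "(real ^ 'n) set" where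
  "integer_lattice = {x. \<forall>i. x $ i \<in> \<int>}"

definition lattice_isomorphic :: "(real ^ 'n) set \<Rightarrow> (real ^ 'm) set \<Rightarrow> bool" where
  "lattice_isomorphic P Q \<longleftrightarrow>
     (\<exists>g b. linear g \<and>
        bij_betw (\<lambda>x. g x + b) (affine hull P) (affine hull Q) \<and>
        (\<lambda>x. g x + b) ` (affine hull P \<inter> integer_lattice) = affine hull Q \<inter> integer_lattice \<and>
        (\<lambda>x. g x + b) ` P = Q)"

text \<open>
  The affine function \<open>\<lambda>z. c \<bullet> z - d\<close> vanishes on \<open>H\<close> and is integral on the lattice of the
  affine hull of \<open>H\<close> and \<open>a\<close>. Having the value \<open>1\<close> at the lattice point \<open>a\<close>, it is primitive,
  hence it measures the lattice distance from \<open>H\<close>.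
\<close>

definition lattice_distance_one :: "real ^ 'n \<Rightarrow> (real ^ 'n) set \<Rightarrow> bool" where
  "lattice_distance_one a H \<longleftrightarrow> a \<in> integer_lattice \<and>
     (\<exists>c d. (\<forall>x\<in>H. c \<bullet> x - d = 0) \<and> c \<bullet> a - d = 1 \<and>
        (\<forall>z \<in> affine hull (insert a H) \<inter> integer_lattice. c \<bullet> z - d \<in> \<int>))"

definition height_one_pyramid :: "(real ^ 'n) set \<Rightarrow> (real ^ 'm) set \<Rightarrow> bool" where
  "height_one_pyramid P Q \<longleftrightarrow>
     (\<exists>B a. lattice_isomorphic B Q \<and> lattice_distance_one a (affine hull B) \<and>
        P = convex hull (insert a B))"

end

theory Submission
  imports Defs
begin

text \<open>
  Subtracting the first coordinate, which is affine, turns \<open>\<kappa>\<close> into minus the indicator of a single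
  vertex \<open>w\<close>. So the subdivision is the pulling of \<open>w\<close>: its maximal cells are the
  pyramids with apex \<open>w\<close> over the \<open>n\<close> facets avoiding \<open>w\<close>, namely \<open>x\<^sub>i = 0\<close> if \<open>w\<^sub>i = 1\<close> and \<open>x\<^sub>i = 1\<close>
  if \<open>w\<^sub>i = 0\<close>. A segment from \<open>w\<close> to a vertex at distance two is a cell, but not an edge of the
  hypersimplex.

  If \<open>\<omega>\<close> induces the same subdivision, it agrees with an affine function \<open>f\<^sub>i\<close> on the \<open>i\<close>-th cell. Let
  \<open>y\<^sub>i\<close> be the affine function that vanishes on the \<open>i\<close>-th facet and is \<open>1\<close> at \<open>w\<close>. Since \<open>f\<^sub>i\<close> and \<open>f\<^sub>j\<close>
  agree at \<open>w\<close> and on a ridge, \<open>f\<^sub>i - f\<^sub>j = c\<^sub>i\<^sub>j (y\<^sub>i - y\<^sub>j)\<close>, and comparing three indices shows that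
  all \<open>c\<^sub>i\<^sub>j\<close> are equal to one \<open>c\<close>. Then \<open>f\<^sub>i - c y\<^sub>i\<close> does not depend on \<open>i\<close>, and \<open>\<omega>\<close> is this affine
  function plus \<open>c\<close> times the indicator of \<open>w\<close>, with \<open>c < 0\<close>.
\<close>

subsection \<open>Regular subdivisions of point configurations\<close>

definition char_vec :: "'n::finite set \<Rightarrow> real ^ 'n" where
  "char_vec X = (\<Sum>i\<in>X. axis i 1)"

lemma char_vec_nth [simp]: "char_vec X $ i = of_bool (i \<in> X)"
  by (simp add: char_vec_def axis_def if_distrib cong: if_cong)

lemma char_vec_eq_iff [simp]: "char_vec X = char_vec Y \<longleftrightarrow> X = Y"
  by (auto simp: vec_eq_iff)

lemma inner_char_vec: "a \<bullet> char_vec X = sum (($) a) X"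
  by (simp add: char_vec_def inner_sum_right inner_axis)

lemma inner_char_vec_char_vec: "char_vec X \<bullet> char_vec Y = real (card (X \<inter> Y))"
  by (simp add: inner_char_vec sum.If_cases Int_commute flip: sum.inter_restrict)

lemma hypersimplex_vertices_eq: "hypersimplex_vertices k = char_vec ` {X. card X = k}"
  by (auto simp: hypersimplex_vertices_def char_vec_def)

lemma finite_hypersimplex_vertices [simp]: "finite (hypersimplex_vertices k)"
  by (simp add: hypersimplex_vertices_eq)

lemma char_vec_in_hypersimplex_vertices [simp]:
  "char_vec X \<in> hypersimplex_vertices k \<longleftrightarrow> card X = k"
  by (auto simp: hypersimplex_vertices_eq)

lemma card_Int_less:
  assumes "card X = k" "card Y = k" "X \<noteq> Y"
  shows "card (X \<inter> Y) < card (Y :: 'a::finite set)"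
  using assms by (metis card_subset_eq finite inf.cobounded1 inf.cobounded2 order_less_le card_mono)

text \<open>Distinct \<open>k\<close>-sets share at most \<open>k - 1\<close> elements, so the
  halfspace of inner product at most \<open>k - 1\<close> with \<open>char_vec X\<close> contains
  every other vertex and excludes \<open>char_vec X\<close>.\<close>

lemma char_vec_in_convex_hull_iff:
  assumes "card X = k" and "\<And>Y. Y \<in> T \<Longrightarrow> card Y = k"
  shows "char_vec X \<in> convex hull (char_vec ` T) \<longleftrightarrow> X \<in> T"
proof
  assume *: "char_vec X \<in> convex hull (char_vec ` T)"
  show "X \<in> T"
  proof (rule ccontr)
    assume "X \<notin> T"
    have "char_vec ` T \<subseteq> {x. char_vec X \<bullet> x \<le> real k - 1}"
    proof (clarsimp simp: inner_char_vec_char_vec)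
      fix Y assume "Y \<in> T"
      then have "card (X \<inter> Y) < k"
        using card_Int_less[of X k Y] assms \<open>X \<notin> T\<close> by auto
      then show "real (card (X \<inter> Y)) \<le> real k - 1" by linarith
    qed
    then have "convex hull (char_vec ` T) \<subseteq> {x. char_vec X \<bullet> x \<le> real k - 1}"
      by (simp add: hull_minimal convex_halfspace_le)
    with * have "char_vec X \<bullet> char_vec X \<le> real k - 1" by auto
    then show False by (simp add: inner_char_vec_char_vec assms)
  qed
qed (simp add: hull_inc)

text \<open>Each vertex is recovered from the hull, so cells can be compared as families of
  sets.\<close>

lemma convex_hull_char_vec_eq_iff:
  assumes "\<And>Y. Y \<in> S \<union> T \<Longrightarrow> card Y = k"
  shows "convex hull (char_vec ` S) = convex hull (char_vec ` T) \<longleftrightarrow> S = T"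
proof
  assume eq: "convex hull (char_vec ` S) = convex hull (char_vec ` T)"
  have "X \<in> S \<longleftrightarrow> X \<in> T" if "card X = k" for X
    using char_vec_in_convex_hull_iff[of X k S] char_vec_in_convex_hull_iff[of X k T] assms eq that
    by simp
  with assms show "S = T" by auto
qed simp

text \<open>The maximizers form a face, and a face of a polytope is the hull of the generators lying
  in it.\<close>

lemma convex_hull_argmax:
  fixes c :: "'a::euclidean_space"
  assumes "finite A"
  shows "{p \<in> convex hull A. \<forall>q \<in> convex hull A. c \<bullet> q \<le> c \<bullet> p} =
         convex hull {p \<in> A. \<forall>q \<in> A. c \<bullet> q \<le> c \<bullet> p}" (is "?F = convex hull ?T")
proof
  have bound: "c \<bullet> q \<le> c \<bullet> p" if "p \<in> ?T" "q \<in> convex hull A" for p q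
    using that hull_minimal[of A "{q. c \<bullet> q \<le> c \<bullet> p}" convex] by (auto simp: convex_halfspace_le)
  have "?F face_of convex hull A"
  proof (cases "?F = {}")
    case False
    then obtain p where p: "p \<in> ?F" by blast
    then have "?F = convex hull A \<inter> {x. c \<bullet> x = c \<bullet> p}" by (auto intro: antisym)
    then show ?thesis
      using p face_of_Int_supporting_hyperplane_le[of "convex hull A" c "c \<bullet> p"] by auto
  qed (simp only: empty_face_of)
  then obtain S where "S \<subseteq> A" and S: "?F = convex hull S"
    using face_of_convex_hull_subset[of A ?F] assms finite_imp_compact by blast
  then have "S \<subseteq> ?F" by (metis (no_types, lifting) hull_subset)
  with \<open>S \<subseteq> A\<close> have "S \<subseteq> ?T" by (auto simp: hull_inc)
  then show "?F \<subseteq> convex hull ?T" unfolding S by (rule hull_mono)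
  have "?T \<subseteq> ?F" using bound by (auto simp: hull_inc)
  moreover have "convex ?F" using S by (metis convex_convex_hull)
  ultimately show "convex hull ?T \<subseteq> ?F" by (rule hull_minimal)
qed

text \<open>These are the points of \<open>V\<close> where the largest affine function of slope
  \<open>a\<close> below \<open>\<omega>\<close> touches \<open>\<omega>\<close>. They span the
  lower face with outer normal \<open>(a, -1)\<close>.\<close>

definition tight_vertices :: "'a::euclidean_space set \<Rightarrow> ('a \<Rightarrow> real) \<Rightarrow> 'a \<Rightarrow> 'a set" where
  "tight_vertices V \<omega> a = {v \<in> V. \<forall>u\<in>V. a \<bullet> u - \<omega> u \<le> a \<bullet> v - \<omega> v}"

text \<open>Only the direction of an outer normal counts; division by \<open>- b > 0\<close> makes
  its last coordinate -1.\<close>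

lemma fst_lower_face:
  assumes "finite V" and "b < 0"
  shows "fst ` {p \<in> lifted_polytope V \<omega>. \<forall>q \<in> lifted_polytope V \<omega>. (a, b) \<bullet> q \<le> (a, b) \<bullet> p}
         = convex hull (tight_vertices V \<omega> ((- 1 / b) *\<^sub>R a))"
proof -
  define L where "L = (\<lambda>v. (v, \<omega> v)) ` V"
  have "(((- 1 / b) *\<^sub>R a) \<bullet> u - \<omega> u \<le> ((- 1 / b) *\<^sub>R a) \<bullet> v - \<omega> v) \<longleftrightarrow>
        a \<bullet> u + b * \<omega> u \<le> a \<bullet> v + b * \<omega> v" for u v
  proof -
    have "((- 1 / b) *\<^sub>R a) \<bullet> x - \<omega> x = (a \<bullet> x + b * \<omega> x) / (- b)" for x
      using \<open>b < 0\<close> by (simp add: field_simps)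
    then show ?thesis
      using \<open>b < 0\<close> by (simp only: divide_le_cancel) simp
  qed
  then have *: "{p \<in> L. \<forall>q\<in>L. (a, b) \<bullet> q \<le> (a, b) \<bullet> p} =
      (\<lambda>v. (v, \<omega> v)) ` tight_vertices V \<omega> ((- 1 / b) *\<^sub>R a)"
    by (auto simp: L_def tight_vertices_def)
  have "fst ` (convex hull {p \<in> L. \<forall>q\<in>L. (a, b) \<bullet> q \<le> (a, b) \<bullet> p}) =
      convex hull (fst ` (\<lambda>v. (v, \<omega> v)) ` tight_vertices V \<omega> ((- 1 / b) *\<^sub>R a))"
    unfolding * by (simp add: convex_hull_linear_image linear_fst)
  then show ?thesis
    using convex_hull_argmax[of L "(a, b)"] \<open>finite V\<close>
    by (simp add: lifted_polytope_def L_def image_image)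
qed

lemma regular_subdivision_eq:
  assumes "finite V"
  shows "regular_subdivision V \<omega> = range (\<lambda>a. convex hull (tight_vertices V \<omega> a))"
proof
  show "regular_subdivision V \<omega> \<subseteq> range (\<lambda>a. convex hull (tight_vertices V \<omega> a))"
    by (auto simp: regular_subdivision_def lower_face_def fst_lower_face[OF assms])
  show "range (\<lambda>a. convex hull (tight_vertices V \<omega> a)) \<subseteq> regular_subdivision V \<omega>"
  proof clarify
    fix a
    have "lower_face {p \<in> lifted_polytope V \<omega>. \<forall>q \<in> lifted_polytope V \<omega>. (a, -1) \<bullet> q \<le> (a, -1) \<bullet> p}
        (lifted_polytope V \<omega>)"
      unfolding lower_face_def by (intro exI[of _ a] exI[of _ "-1"]) simp
    then show "convex hull (tight_vertices V \<omega> a) \<in> regular_subdivision V \<omega>"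
      using fst_lower_face[OF assms, of "-1" \<omega> a]
      unfolding regular_subdivision_def mem_Collect_eq by (intro exI conjI) auto
  qed
qed

text \<open>The slope \<open>a\<close> for \<open>\<omega>\<close> corresponds to the slope
  \<open>c *\<^sub>R a + b\<close> for \<open>\<omega>'\<close>, and this substitution permutes all
  slopes.\<close>

lemma regular_subdivision_scale_translate:
  assumes "finite V" and "c > 0" and \<omega>': "\<And>v. v \<in> V \<Longrightarrow> \<omega>' v = c * \<omega> v + b \<bullet> v + d"
  shows "regular_subdivision V \<omega>' = regular_subdivision V \<omega>"
proof -
  have tight: "tight_vertices V \<omega>' (c *\<^sub>R a + b) = tight_vertices V \<omega> a" for a
  proof -
    have "(c *\<^sub>R a + b) \<bullet> v - \<omega>' v = c * (a \<bullet> v - \<omega> v) - d" if "v \<in> V" for v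
      using \<omega>'[OF that] by (simp add: algebra_simps)
    then show ?thesis
      using \<open>c > 0\<close> unfolding tight_vertices_def by auto
  qed
  have "surj (\<lambda>a. c *\<^sub>R a + b)"
    using \<open>c > 0\<close> by (intro surjI[of _ "\<lambda>x. (1 / c) *\<^sub>R (x - b)"]) simp
  then have "range (\<lambda>a. convex hull (tight_vertices V \<omega>' a)) =
      range (\<lambda>a. convex hull (tight_vertices V \<omega>' (c *\<^sub>R a + b)))"
    by (metis (mono_tags) image_image)
  then show ?thesis
    by (simp add: regular_subdivision_eq \<open>finite V\<close> tight)
qed

subsection \<open>Affine functions on the vertices of a hypersimplex\<close>

text \<open>Builds vertices with a few prescribed coordinates: \<open>A\<close> collects the ones,
  \<open>B\<close> the zeros.\<close>

lemma exists_card_eq_separating: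
  fixes A B :: "'a::finite set"
  assumes "card A \<le> k" "k + card B \<le> CARD('a)" "A \<inter> B = {}"
  obtains X where "card X = k" "A \<subseteq> X" "X \<inter> B = {}"
proof -
  have "card (- B) = CARD('a) - card B" by (simp add: Compl_eq_Diff_UNIV card_Diff_subset)
  then have "k \<le> card (- B)" using assms(2) by linarith
  moreover have "A \<subseteq> - B" using assms(3) by blast
  ultimately obtain X where "A \<subseteq> X" "X \<subseteq> - B" "card X = k"
    using exists_subset_between[of A k "- B"] assms(1) by auto
  then show thesis using that by blast
qed

text \<open>Affine functions on \<open>real ^ 'a\<close> restricted to the vertices of the \<open>k\<close>-th hypersimplex.\<close>

definition modular_on :: "nat \<Rightarrow> ('a set \<Rightarrow> real) \<Rightarrow> bool" where
  "modular_on k f \<longleftrightarrow> (\<exists>a d. \<forall>X. card X = k \<longrightarrow> f X = sum a X + d)"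

lemma modular_onI: "(\<And>X. card X = k \<Longrightarrow> f X = sum a X + d) \<Longrightarrow> modular_on k f"
  unfolding modular_on_def by blast

lemma modular_on_lincomb:
  assumes "modular_on k f" "modular_on k g"
  shows "modular_on k (\<lambda>X. s * f X + t * g X)"
proof -
  obtain a d b e where "\<And>X. card X = k \<Longrightarrow> f X = sum a X + d"
    and "\<And>X. card X = k \<Longrightarrow> g X = sum b X + e"
    using assms unfolding modular_on_def by blast
  then show ?thesis
    by (intro modular_onI[of _ _ "\<lambda>i. s * a i + t * b i" "s * d + t * e"])
      (simp add: sum.distrib sum_distrib_left algebra_simps)
qed

lemma modular_on_cong:
  "(\<And>X. card X = k \<Longrightarrow> f X = g X) \<Longrightarrow> modular_on k f \<longleftrightarrow> modular_on k g"
  unfolding modular_on_def by auto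

lemma modular_on_0: "modular_on k (\<lambda>X. 0)"
  by (intro modular_onI[of _ _ "\<lambda>i. 0" 0]) simp

lemma modular_on_scale: "modular_on k f \<Longrightarrow> modular_on k (\<lambda>X. s * f X)"
  using modular_on_lincomb[of k f f s 0] by simp

lemma modular_on_add: "modular_on k f \<Longrightarrow> modular_on k g \<Longrightarrow> modular_on k (\<lambda>X. f X + g X)"
  using modular_on_lincomb[of k f g 1 1] by simp

lemma modular_on_diff: "modular_on k f \<Longrightarrow> modular_on k g \<Longrightarrow> modular_on k (\<lambda>X. f X - g X)"
  using modular_on_lincomb[of k f g 1 "-1"] by simp

lemma modular_on_mem:
  "modular_on k (\<lambda>X. of_bool (i \<in> (X :: 'a::finite set)))"
  by (intro modular_onI[of _ _ "\<lambda>j. of_bool (i = j)" 0]) (simp add: of_bool_def)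

text \<open>This is the coordinate \<open>x_i\<close> for \<open>i \<in> W\<close> and
  \<open>1 - x_i\<close> otherwise.\<close>

lemma modular_on_agree: "modular_on k (\<lambda>X. of_bool ((i \<in> (X :: 'a::finite set)) = (i \<in> W)))"
proof (cases "i \<in> W")
  case False
  then show ?thesis
    by (intro modular_onI[of _ _ "\<lambda>j. - of_bool (i = j)" 1]) (simp add: of_bool_def sum_negf)
qed (use modular_on_mem in simp)

text \<open>
  Exchanging two elements inside the ridge shows that the coefficients other than the \<open>i\<close>-th and \<open>j\<close>-th
  coincide. The cardinality assumptions exclude the ridges that are single vertices.
\<close>

lemma modular_on_vanishing_on_ridge:
  fixes W :: "'a::finite set"
  assumes "card W = k" "2 \<le> k" "k + 2 \<le> CARD('a)" "i \<noteq> j"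
    and in_in: "i \<in> W \<Longrightarrow> j \<in> W \<Longrightarrow> k + 3 \<le> CARD('a)"
    and out_out: "i \<notin> W \<Longrightarrow> j \<notin> W \<Longrightarrow> 3 \<le> k"
    and "modular_on k h" "h W = 0"
    and h0: "\<And>X. card X = k \<Longrightarrow> (i \<in> X) \<noteq> (i \<in> W) \<Longrightarrow> (j \<in> X) \<noteq> (j \<in> W) \<Longrightarrow> h X = 0"
  shows "\<exists>c. \<forall>X. card X = k \<longrightarrow>
    h X = c * (of_bool ((i \<in> X) = (i \<in> W)) - of_bool ((j \<in> X) = (j \<in> W)))"
proof -
  obtain a d where h: "\<And>X. card X = k \<Longrightarrow> h X = sum a X + d"
    using \<open>modular_on k h\<close> unfolding modular_on_def by blast
  have ex: "\<exists>X. card X = k \<and> (i \<in> X) \<noteq> (i \<in> W) \<and> (j \<in> X) \<noteq> (j \<in> W) \<and> p \<in> X \<and> q \<notin> X"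
    if "p \<noteq> q" "p \<notin> {i, j}" "q \<notin> {i, j}" for p q
  proof -
    \<comment> \<open>\<open>A\<close> has three elements when \<open>i\<close> and \<open>j\<close>
      both lie outside \<open>W\<close>, and \<open>B\<close> when both lie in \<open>W\<close>;
      \<open>out_out\<close> and \<open>in_in\<close> make room for them.\<close>
    define A where "A = insert p ({i, j} - W)"
    define B where "B = insert q ({i, j} \<inter> W)"
    have "card A \<le> k" "k + card B \<le> CARD('a)" "A \<inter> B = {}"
      using assms(2-4) in_in out_out that
      by (cases "i \<in> W"; cases "j \<in> W"; auto simp: A_def B_def insert_Diff_if)+
    then obtain X where "card X = k" "A \<subseteq> X" "X \<inter> B = {}"
      by (rule exists_card_eq_separating)
    then show ?thesis
      by (intro exI[of _ X]) (auto simp: A_def B_def)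
  qed
  have a_eq: "a p = a q" if pq: "p \<notin> {i, j}" "q \<notin> {i, j}" for p q
  proof (cases "p = q")
    case False
    obtain X where X: "card X = k" "(i \<in> X) \<noteq> (i \<in> W)" "(j \<in> X) \<noteq> (j \<in> W)" "p \<in> X" "q \<notin> X"
      using ex[OF False pq] by blast
    define Y where "Y = insert q (X - {p})"
    have "card Y = k"
      using X \<open>2 \<le> k\<close> by (simp add: Y_def)
    moreover have "(i \<in> Y) \<noteq> (i \<in> W)" "(j \<in> Y) \<noteq> (j \<in> W)"
      using X pq by (auto simp: Y_def)
    ultimately have "h Y = 0" by (rule h0)
    moreover have "h X = 0" using X by (intro h0)
    moreover have "sum a Y = a q + sum a (X - {p})" "sum a X = a p + sum a (X - {p})"
      using X by (simp_all add: Y_def sum.remove[of X p])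
    ultimately show ?thesis
      using h[OF \<open>card Y = k\<close>] h[OF \<open>card X = k\<close>] by simp
  qed simp
  have "card {i, j} < CARD('a)" using \<open>i \<noteq> j\<close> assms(2,3) by simp
  then obtain p0 where p0: "p0 \<notin> {i, j}"
    by (metis UNIV_eq_I less_irrefl)
  obtain q0 where q0: "q0 \<notin> {i, j, p0}"
  proof -
    have "card {i, j, p0} < CARD('a)" using \<open>i \<noteq> j\<close> p0 assms(2,3) by (simp add: card_insert_if)
    then show thesis using that
      by (metis UNIV_eq_I less_irrefl)
  qed
  define t where "t = a p0"
  have a_t: "a p = t" if "p \<notin> {i, j}" for p
    unfolding t_def using that p0 by (rule a_eq)
  \<comment> \<open>Only the coordinates \<open>i\<close> and \<open>j\<close> still matter. These
    are the coefficients of \<open>h\<close> in \<open>y_i\<close>, \<open>y_j\<close> and 1; the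
    sign flips where \<open>y_i\<close> is \<open>1 - x_i\<close>.\<close>
  define \<alpha> where "\<alpha> = (if i \<in> W then a i - t else t - a i)"
  define \<beta> where "\<beta> = (if j \<in> W then a j - t else t - a j)"
  define \<gamma> where "\<gamma> = d + k * t + (if i \<in> W then 0 else a i - t) + (if j \<in> W then 0 else a j - t)"
  have hX: "h X = \<alpha> * of_bool ((i \<in> X) = (i \<in> W)) + \<beta> * of_bool ((j \<in> X) = (j \<in> W)) + \<gamma>"
    if "card X = k" for X
  proof -
    have "sum a X = (\<Sum>x\<in>X. t + (if x = i then a i - t else 0) + (if x = j then a j - t else 0))"
      using a_t \<open>i \<noteq> j\<close> by (intro sum.cong) auto
    also have "\<dots> = k * t + (if i \<in> X then a i - t else 0) + (if j \<in> X then a j - t else 0)"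
      using that by (simp add: sum.distrib)
    finally show ?thesis
      using h[OF that] by (auto simp: \<alpha>_def \<beta>_def \<gamma>_def)
  qed
  obtain X0 where "card X0 = k" "(i \<in> X0) \<noteq> (i \<in> W)" "(j \<in> X0) \<noteq> (j \<in> W)"
    using ex[of p0 q0] p0 q0 by auto
  \<comment> \<open>Both \<open>y_i\<close> and \<open>y_j\<close> vanish on the ridge, which
    isolates \<open>\<gamma>\<close>; both are 1 at \<open>W\<close>, which gives
    \<open>\<alpha> + \<beta>\<close>.\<close>
  then have "\<gamma> = 0" using h0[of X0] hX[of X0] by simp
  moreover have "\<alpha> + \<beta> = 0"
    using hX[OF \<open>card W = k\<close>] \<open>h W = 0\<close> \<open>\<gamma> = 0\<close> by simp
  ultimately show ?thesis
    using hX by (intro exI[of _ \<alpha>]) (auto simp: algebra_simps)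
qed

text \<open>
  For \<open>(k, n) = (2, 4)\<close> this fails: the ridges between two facets of the same kind are points.
  Otherwise at least one of the two kinds, \<open>W\<close> or its complement, has only nondegenerate ridges.
\<close>

lemma glue_modular_on:
  fixes W :: "'a::finite set" and f :: "'a \<Rightarrow> 'a set \<Rightarrow> real"
  defines "y \<equiv> \<lambda>i X. of_bool ((i \<in> X) = (i \<in> W)) :: real"
  assumes "card W = k" "2 \<le> k" "k + 2 \<le> CARD('a)" "(k, CARD('a)) \<noteq> (2, 4)"
    and modular: "\<And>i. modular_on k (f i)"
    and W: "\<And>i j. f i W = f j W"
    and ridge: "\<And>i j X. card X = k \<Longrightarrow> (i \<in> X) \<noteq> (i \<in> W) \<Longrightarrow> (j \<in> X) \<noteq> (j \<in> W) \<Longrightarrow> f i X = f j X"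
  shows "\<exists>F c. modular_on k F \<and> (\<forall>i X. card X = k \<longrightarrow> f i X = F X + c * y i X)"
proof -
  define A where "A = (if 3 \<le> k then - W else W)"
  \<comment> \<open>If \<open>k = 2\<close>, excluding \<open>(2, 4)\<close> leaves at least five
    elements, that is, \<open>k + 3\<close>.\<close>
  have A: "A = - W \<and> 3 \<le> k \<or> A = W \<and> k + 3 \<le> CARD('a)"
    using assms(2-5) by (auto simp: A_def)
  have "\<exists>c. \<forall>X. card X = k \<longrightarrow> f i X - f j X = c * (y i X - y j X)"
    if "i \<noteq> j" "i \<in> A \<or> j \<in> A" for i j
    unfolding y_def
  proof (rule modular_on_vanishing_on_ridge[OF assms(2-4) \<open>i \<noteq> j\<close>])
    show "i \<in> W \<Longrightarrow> j \<in> W \<Longrightarrow> k + 3 \<le> CARD('a)" "i \<notin> W \<Longrightarrow> j \<notin> W \<Longrightarrow> 3 \<le> k"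
      using A that by auto
    show "modular_on k (\<lambda>X. f i X - f j X)"
      by (intro modular_on_diff modular)
    show "f i W - f j W = 0"
      using W[of i j] by simp
    show "f i X - f j X = 0" if "card X = k" "(i \<in> X) \<noteq> (i \<in> W)" "(j \<in> X) \<noteq> (j \<in> W)" for X
      using ridge[OF that] by simp
  qed
  then obtain c where c: "\<And>i j X. i \<noteq> j \<Longrightarrow> i \<in> A \<or> j \<in> A \<Longrightarrow> card X = k \<Longrightarrow>
      f i X - f j X = c i j * (y i X - y j X)"
    by metis
  have card_W': "card (- W) = CARD('a) - k" using assms(2) by (simp add: Compl_eq_Diff_UNIV card_Diff_subset)
  have separate: "\<exists>X. card X = k \<and> y a X = 1 \<and> y a' X = 0 \<and> y b X = 0"
    if "a \<in> A" "a' \<in> A" "a \<noteq> a'" "b \<notin> A" for a a' b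
  proof (cases "A = W")
    case True
    have "card {a, b} \<le> k" "k + card {a'} \<le> CARD('a)" "{a, b} \<inter> {a'} = {}"
      using assms(3,4) that by (auto simp: card_insert_if)
    then obtain X where "card X = k" "{a, b} \<subseteq> X" "X \<inter> {a'} = {}"
      by (rule exists_card_eq_separating)
    with True that show ?thesis by (intro exI[of _ X]) (auto simp: y_def)
  next
    case False
    then have "A = - W" using A by blast
    have "card {a'} \<le> k" "k + card {a, b} \<le> CARD('a)" "{a'} \<inter> {a, b} = {}"
      using assms(3,4) that by (auto simp: card_insert_if)
    then obtain X where "card X = k" "{a'} \<subseteq> X" "X \<inter> {a, b} = {}"
      by (rule exists_card_eq_separating)
    with \<open>A = - W\<close> that show ?thesis by (intro exI[of _ X]) (auto simp: y_def)
  qed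
  \<comment> \<open>The differences \<open>f a - f a'\<close> and \<open>f a' - f b\<close> add up
    to \<open>f a - f b\<close>. Evaluating where only \<open>y a\<close>, or only
    \<open>y a'\<close>, is nonzero compares two coefficients.\<close>
  have c1: "c a a' = c a b" and c2: "c a a' = c a' b"
    if ab: "a \<in> A" "a' \<in> A" "a \<noteq> a'" "b \<notin> A" for a a' b
  proof -
    have ne: "a \<noteq> b" "a' \<noteq> b" using ab by auto
    obtain X where "card X = k" "y a X = 1" "y a' X = 0" "y b X = 0"
      using separate[OF ab] by blast
    then show "c a a' = c a b"
      using c[of a a' X] c[of a b X] c[of a' b X] ne ab by simp
    obtain X where "card X = k" "y a' X = 1" "y a X = 0" "y b X = 0"
      using separate[of a' a b] ab by blast
    then show "c a a' = c a' b"
      using c[of a a' X] c[of a b X] c[of a' b X] ne ab by simp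
  qed
  have "1 < card A" using A card_W' assms(2-4) by auto
  then obtain a0 a1 where a01: "a0 \<in> A" "a1 \<in> A" "a0 \<noteq> a1"
    by (metis card_le_Suc0_iff_eq finite not_less One_nat_def)
  obtain b0 where "b0 \<notin> A"
  proof -
    have "A \<noteq> UNIV" using A card_W' assms(2-4) by auto
    then show thesis using that by blast
  qed
  define s where "s = c a0 a1"
  \<comment> \<open>Both \<open>c a b\<close> and \<open>c a0 b\<close> equal \<open>c a0 a\<close>,
    which removes the dependence on \<open>a\<close>; comparison with \<open>a1\<close> removes the
    dependence on \<open>b\<close>.\<close>
  have c_eq: "c a b = s" if "a \<in> A" "b \<notin> A" for a b
  proof -
    have "c a0 b = s" using c1[of a0 a1 b] a01 that by (simp add: s_def)
    moreover have "c a b = c a0 b" if "a \<noteq> a0"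
      using c1[of a0 a b] c2[of a0 a b] a01 \<open>a \<in> A\<close> \<open>b \<notin> A\<close> that by simp
    ultimately show ?thesis by blast
  qed
  have diff: "f a X - f b X = s * (y a X - y b X)" if "a \<in> A" "b \<notin> A" "card X = k" for a b X
    using c[of a b X] c_eq[of a b] that by auto
  \<comment> \<open>The index-free function is read off at \<open>b0\<close>, in the shape required
    by \<open>modular_on_lincomb\<close>. Other indices outside \<open>A\<close> are compared with
    \<open>b0\<close> by way of \<open>a0\<close>.\<close>
  define F where "F = (\<lambda>X. 1 * f b0 X + (- s) * y b0 X)"
  have "modular_on k F"
    unfolding F_def y_def by (intro modular_on_lincomb modular modular_on_agree)
  moreover have "f i X = F X + s * y i X" if "card X = k" for i X
  proof (cases "i \<in> A")
    case True
    then show ?thesis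
      using diff[of i b0 X] \<open>b0 \<notin> A\<close> that by (simp add: F_def algebra_simps)
  next
    case False
    then show ?thesis
      using diff[of a0 i X] diff[of a0 b0 X] \<open>b0 \<notin> A\<close> a01 that by (simp add: F_def algebra_simps)
  qed
  ultimately show ?thesis by blast
qed

subsection \<open>The lineality space of the secondary fan\<close>

lemma sum_nth_eq_inner: "sum a X = (\<chi> i. a i) \<bullet> char_vec X"
  by (simp add: inner_char_vec)

text \<open>An affine function sees only the common midpoint of the two pairs. The resulting
  four-term functional later detects the coefficient of \<open>pull\<close>.\<close>

lemma modular_on_parallelogram:
  assumes "modular_on k F" "card P = k" "card Q = k" "card X = k" "card Y = k"
    and "char_vec P + char_vec Q = char_vec X + char_vec Y"
  shows "F P + F Q = F X + F Y"
proof -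
  obtain a d where F: "\<And>X. card X = k \<Longrightarrow> F X = sum a X + d"
    using assms(1) unfolding modular_on_def by blast
  have "(\<chi> i. a i) \<bullet> (char_vec P + char_vec Q) = (\<chi> i. a i) \<bullet> (char_vec X + char_vec Y)"
    using assms(6) by simp
  then show ?thesis
    using assms(2-5) by (simp add: F sum_nth_eq_inner inner_add_right)
qed

section \<open>Subdivisions of the hypersimplex in terms of families of
  \<open>k\<close>-sets\<close>

definition tight_sets :: "nat \<Rightarrow> (real ^ 'n \<Rightarrow> real) \<Rightarrow> real ^ 'n \<Rightarrow> 'n::finite set set" where
  "tight_sets k \<omega> a = {X. card X = k \<and> (\<forall>Y. card Y = k \<longrightarrow>
     sum (($) a) Y - \<omega> (char_vec Y) \<le> sum (($) a) X - \<omega> (char_vec X))}"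

lemma regular_subdivision_hypersimplex:
  "regular_subdivision (hypersimplex_vertices k) \<omega> =
   range (\<lambda>a. convex hull (char_vec ` tight_sets k \<omega> a))"
proof -
  have "tight_vertices (hypersimplex_vertices k) \<omega> a = char_vec ` tight_sets k \<omega> a" for a
    by (auto simp: tight_vertices_def tight_sets_def hypersimplex_vertices_eq inner_char_vec)
  then show ?thesis by (simp add: regular_subdivision_eq)
qed

lemma convex_hull_in_regular_subdivision_iff:
  assumes "\<And>X. X \<in> T \<Longrightarrow> card X = k"
  shows "convex hull (char_vec ` T) \<in> regular_subdivision (hypersimplex_vertices k) \<omega> \<longleftrightarrow>
    (\<exists>a. tight_sets k \<omega> a = T)"
proof -
  have "convex hull (char_vec ` T) = convex hull (char_vec ` tight_sets k \<omega> a) \<longleftrightarrow>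
      T = tight_sets k \<omega> a" for a
    using assms by (intro convex_hull_char_vec_eq_iff[of _ _ k]) (auto simp: tight_sets_def)
  then show ?thesis
    unfolding regular_subdivision_hypersimplex by (auto simp: image_iff)
qed

lemma regular_subdivision_add_modular:
  assumes "c > 0" "modular_on k F"
    and \<omega>': "\<And>X. card X = k \<Longrightarrow> \<omega>' (char_vec X) = c * \<omega> (char_vec X) + F X"
  shows "regular_subdivision (hypersimplex_vertices k) \<omega>' =
    regular_subdivision (hypersimplex_vertices k) \<omega>"
proof -
  obtain a d where F: "\<And>X. card X = k \<Longrightarrow> F X = sum a X + d"
    using assms(2) unfolding modular_on_def by blast
  show ?thesis
    using \<open>c > 0\<close> \<omega>' F
    by (intro regular_subdivision_scale_translate[where c = c and b = "\<chi> i. a i" and d = d])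
      (auto simp: hypersimplex_vertices_eq sum_nth_eq_inner)
qed

text \<open>Only the finitely many values at the \<open>char_vec X\<close> matter: the set is the
  preimage, under the continuous evaluation map \<open>\<Phi>\<close>, of a linear subspace of a
  finite-dimensional space.\<close>

lemma closed_modular: "closed {l :: real ^ 'n \<Rightarrow> real. modular_on k (\<lambda>X. l (char_vec X))}"
proof -
  define \<Phi> :: "(real ^ 'n \<Rightarrow> real) \<Rightarrow> real ^ 'n set" where "\<Phi> = (\<lambda>l. \<chi> X. l (char_vec X))"
  have nth: "($) (0 :: real ^ 'n set) = (\<lambda>X. 0)" "($) (x + y) = (\<lambda>X. x $ X + y $ X)"
    "($) (c *\<^sub>R x) = (\<lambda>X. c * x $ X)" for x y :: "real ^ 'n set" and c
    by auto
  have "subspace {v :: real ^ 'n set. modular_on k (($) v)}"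
    unfolding subspace_def mem_Collect_eq nth
    by (simp add: modular_on_0 modular_on_add modular_on_scale)
  then have "closed {v :: real ^ 'n set. modular_on k (($) v)}"
    by (rule closed_subspace)
  moreover have "continuous_on UNIV \<Phi>"
    unfolding \<Phi>_def by (intro continuous_on_vec_lambda continuous_on_product_coordinates)
  ultimately have "closed (\<Phi> -` {v. modular_on k (($) v)})"
    by (rule closed_vimage)
  moreover have "($) (\<Phi> l) = (\<lambda>X. l (char_vec X))" for l
    by (auto simp: \<Phi>_def)
  ultimately show ?thesis
    by (simp add: vimage_def)
qed

text \<open>Let \<open>e\<close> tend to 0. Inclusions into secondary cones are obtained this
  way.\<close>

lemma in_closure_along_ray:
  fixes f g :: "'a \<Rightarrow> real"
  assumes "\<And>e. e > 0 \<Longrightarrow> (\<lambda>x. f x + e * g x) \<in> T"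
  shows "f \<in> closure T"
proof -
  have "continuous_on (closure {0<..}) (\<lambda>e x. f x + e * g x)"
    by (intro continuous_on_coordinatewise_then_product continuous_intros)
  then have "(\<lambda>e x. f x + e * g x) ` closure {0<..} \<subseteq> closure T"
    using assms closure_subset[of T] by (intro image_closure_subset) auto
  moreover have "(0::real) \<in> closure {0<..}" by simp
  ultimately show ?thesis by force
qed

text \<open>For \<subseteq> the cone of the trivial subdivision suffices: functions inducing it are
  affine on the vertices, a closed condition. Conversely, an affine \<open>l\<close> is the limit of
  \<open>l + e * \<omega>\<close>, which induces the same subdivision as
  \<open>\<omega>\<close>.\<close>

lemma secondary_lineality_hypersimplex:
  "secondary_lineality (hypersimplex_vertices k) =
   {l :: real ^ 'n \<Rightarrow> real. modular_on k (\<lambda>X. l (char_vec X))}" (is "?L = ?M")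
proof
  let ?\<Sigma> = "regular_subdivision (hypersimplex_vertices k :: (real ^ 'n) set)"
  show "?L \<subseteq> ?M"
  proof
    fix l assume "l \<in> ?L"
    then have "l \<in> closure {\<omega>. ?\<Sigma> \<omega> = ?\<Sigma> (\<lambda>x. 0)}"
      unfolding secondary_lineality_def secondary_fan_def secondary_cone_def by blast
    moreover have "{\<omega>. ?\<Sigma> \<omega> = ?\<Sigma> (\<lambda>x. 0)} \<subseteq> ?M"
    proof clarify
      fix \<omega> assume "?\<Sigma> \<omega> = ?\<Sigma> (\<lambda>x. 0)"
      moreover have "convex hull (char_vec ` {X. card X = k}) \<in> ?\<Sigma> (\<lambda>x. 0)"
        by (subst convex_hull_in_regular_subdivision_iff) (auto simp: tight_sets_def intro: exI[of _ 0])
      ultimately obtain a where a: "tight_sets k \<omega> a = {X. card X = k}"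
        using convex_hull_in_regular_subdivision_iff[of "{X. card X = k}" k \<omega>] by auto
      have *: "sum (($) a) X - \<omega> (char_vec X) = sum (($) a) Y - \<omega> (char_vec Y)"
        if "card X = k" "card Y = k" for X Y
        using a that unfolding tight_sets_def set_eq_iff mem_Collect_eq by (intro antisym) auto
      show "modular_on k (\<lambda>X. \<omega> (char_vec X))"
      \<comment> \<open>Without \<open>k\<close>-sets the claim is vacuous; otherwise the constant
        term is read off at any \<open>Y\<close>.\<close>
      proof (cases "\<exists>Y :: 'n set. card Y = k")
        case True
        then obtain Y :: "'n set" where "card Y = k" by blast
        then show ?thesis
          using * by (intro modular_onI[of _ _ "($) a" "\<omega> (char_vec Y) - sum (($) a) Y"]) force
      qed (simp add: modular_on_def)
    qed
    then have "closure {\<omega>. ?\<Sigma> \<omega> = ?\<Sigma> (\<lambda>x. 0)} \<subseteq> ?M"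
      by (rule closure_minimal[OF _ closed_modular])
    ultimately show "l \<in> ?M" by blast
  qed
  have cone: "l \<in> secondary_cone (hypersimplex_vertices k) (?\<Sigma> \<omega>)" if "l \<in> ?M" for l \<omega>
    unfolding secondary_cone_def
  proof (rule in_closure_along_ray)
    fix e :: real assume "e > 0"
    then have "?\<Sigma> (\<lambda>x. l x + e * \<omega> x) = ?\<Sigma> \<omega>"
      using that by (intro regular_subdivision_add_modular[of e k "\<lambda>X. l (char_vec X)"]) auto
    then show "(\<lambda>x. l x + e * \<omega> x) \<in> {\<omega>'. ?\<Sigma> \<omega>' = ?\<Sigma> \<omega>}" by simp
  qed
  have minus: "(\<lambda>x. - l x) \<in> ?M" if "l \<in> ?M" for l
    using that modular_on_scale[of k _ "-1"] by auto
  show "?M \<subseteq> ?L"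
  proof
    fix l assume l: "l \<in> ?M"
    have "l \<in> C \<and> (\<lambda>x. - l x) \<in> C" if C: "C \<in> secondary_fan (hypersimplex_vertices k)" for C
    proof -
      obtain \<omega> where "C = secondary_cone (hypersimplex_vertices k) (?\<Sigma> \<omega>)"
        using C unfolding secondary_fan_def by blast
      then show ?thesis
        using cone[OF l] cone[OF minus[OF l]] by blast
    qed
    then show "l \<in> ?L" by (simp add: secondary_lineality_def)
  qed
qed

subsection \<open>Pulling a vertex\<close>

locale pulled_hypersimplex =
  fixes k :: nat and W :: "'n::finite set"
  assumes card_W: "card W = k" and two_le: "2 \<le> k" and le_card: "k + 2 \<le> CARD('n)"
begin

text \<open>The vertices of the facet \<open>x\<^sub>i = 0\<close> or \<open>x\<^sub>i = 1\<close>, whichever avoids \<open>W\<close>.\<close>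

definition facet :: "'n \<Rightarrow> 'n set set" where
  "facet i = {X. card X = k \<and> (i \<in> X) \<noteq> (i \<in> W)}"

definition cell :: "'n \<Rightarrow> (real ^ 'n) set" where
  "cell i = convex hull (char_vec ` insert W (facet i))"

definition pull :: "real ^ 'n \<Rightarrow> real" where
  "pull x = - of_bool (x = char_vec W)"

abbreviation subdivision :: "(real ^ 'n \<Rightarrow> real) \<Rightarrow> (real ^ 'n) set set" where
  "subdivision \<equiv> regular_subdivision (hypersimplex_vertices k)"

lemma card_insert_W_facet: "X \<in> insert W (facet i) \<Longrightarrow> card X = k"
  by (auto simp: facet_def card_W)

text \<open>Makes the cells incomparable, and later provides a vertex at which a supporting affine
  function lies strictly below the lift.\<close>

lemma facet_separation:
  assumes "i \<noteq> j"
  obtains X where "X \<in> facet i" "X \<notin> facet j" "X \<noteq> W"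
proof -
  define A where "A = ({i} - W) \<union> ({j} \<inter> W)"
  define B where "B = ({i} \<inter> W) \<union> ({j} - W)"
  have "card A \<le> k" "k + card B \<le> CARD('n)" "A \<inter> B = {}"
    using two_le le_card assms
    by (cases "i \<in> W"; cases "j \<in> W"; auto simp: A_def B_def insert_Diff_if)+
  then obtain X where "card X = k" "A \<subseteq> X" "X \<inter> B = {}"
    by (rule exists_card_eq_separating)
  then have "X \<in> facet i" "X \<notin> facet j" by (auto simp: facet_def A_def B_def)
  then show thesis using that by (auto simp: facet_def)
qed

text \<open>The slope is the outer normal of the facet. Together with the lift at \<open>W\<close>
  it gives the two indicators in \<open>y\<close>, which exclude each other, so the maximum 1 is
  attained exactly on the facet and at \<open>W\<close>.\<close>

lemma tight_sets_facet: "\<exists>a. tight_sets k pull a = insert W (facet i)"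
proof -
  define a :: "real ^ 'n" where "a = axis i (if i \<in> W then -1 else 1)"
  define y :: "'n set \<Rightarrow> real"
    where "y X = of_bool ((i \<in> X) \<noteq> (i \<in> W)) + of_bool (X = W)" for X
  have "sum (($) a) X - pull (char_vec X) = y X - of_bool (i \<in> W)" for X
    by (auto simp: a_def axis_def y_def pull_def if_distrib cong: if_cong)
  then have "tight_sets k pull a = {X. card X = k \<and> (\<forall>Y. card Y = k \<longrightarrow> y Y \<le> y X)}"
    by (simp add: tight_sets_def)
  also have "\<dots> = {X. card X = k \<and> y X = 1}"
  proof -
    have "y Y \<le> 1" "y W = 1" for Y by (auto simp: y_def)
    then have "(\<forall>Y. card Y = k \<longrightarrow> y Y \<le> y X) \<longleftrightarrow> y X = 1" for X
      using card_W by (metis order.antisym)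
    then show ?thesis by simp
  qed
  also have "\<dots> = insert W (facet i)"
    using card_W by (auto simp: facet_def y_def)
  finally show ?thesis by blast
qed

lemma cell_in_subdivision: "cell i \<in> subdivision pull"
  unfolding cell_def
  by (subst convex_hull_in_regular_subdivision_iff) (auto simp: card_insert_W_facet tight_sets_facet)

text \<open>
  If \<open>W\<close> does not maximize the linear function \<open>a\<close>, the threshold \<open>\<theta>\<close> of the greedy algorithm provides an
  element on which \<open>W\<close> decides differently from all maximizers.
\<close>

lemma tight_sets_subset: "\<exists>i. tight_sets k pull a \<subseteq> insert W (facet i)"
proof (cases "tight_sets k pull a \<subseteq> {W}")
  case False
  then obtain U where U: "U \<in> tight_sets k pull a" "U \<noteq> W" by blast
  define f where "f = sum (($) a)"
  have "card U = k" using U by (simp add: tight_sets_def)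
  have f_bound: "f Y + of_bool (Y = W) \<le> f X"
    if "X \<in> tight_sets k pull a" "X \<noteq> W" "card Y = k" for X Y
    using that by (simp add: tight_sets_def pull_def f_def)
  have f_le: "f Y \<le> f X"
    if "X \<in> tight_sets k pull a" "X \<noteq> W" "card Y = k" for X Y
    using f_bound[OF that] by (cases "Y = W") simp_all
  have f_W: "f W + 1 \<le> f U"
    using f_bound[OF U card_W] by simp
  have f_eq: "f X = f U" if "X \<in> tight_sets k pull a" "X \<noteq> W" for X
    using that U by (intro antisym f_le) (auto simp: tight_sets_def)
  \<comment> \<open>By exchanging \<open>p\<close>, all weights outside \<open>U\<close> turn out to
    be at most \<open>\<theta>\<close>, so \<open>U\<close> is a greedy choice.\<close>
  define \<theta> where "\<theta> = Min ((($) a) ` U)"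
  have "U \<noteq> {}" using \<open>card U = k\<close> two_le by auto
  then have "\<theta> \<in> (($) a) ` U" unfolding \<theta>_def by (intro Min_in) auto
  then obtain p where p: "p \<in> U" "\<theta> = a $ p" by auto
  have U_ge: "\<theta> \<le> a $ q" if "q \<in> U" for q
    using that by (simp add: \<theta>_def)
  have U_le: "a $ q \<le> \<theta>" if "q \<notin> U" for q
  proof -
    have "card (insert q (U - {p})) = k"
      using p that \<open>card U = k\<close> two_le by simp
    then have "f (insert q (U - {p})) \<le> f U" by (rule f_le[OF U])
    then show ?thesis
      using p that by (simp add: f_def sum.remove[of U p])
  qed
  \<comment> \<open>The loss of \<open>X\<close> against the greedy optimum: every summand is
    nonnegative, and on \<open>k\<close>-sets the total is a constant minus
    \<open>f\<close>.\<close>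
  define g where "g = (\<lambda>X. \<Sum>i\<in>UNIV. max 0 (a $ i - \<theta>) - of_bool (i \<in> X) * (a $ i - \<theta>))"
  have g: "g X = g {} - f X + k * \<theta>" if "card X = k" for X
  proof -
    have "(\<Sum>i\<in>UNIV. of_bool (i \<in> X) * (a $ i - \<theta>)) = (\<Sum>i\<in>X. a $ i - \<theta>)"
      by (intro sum.mono_neutral_cong_right) auto
    then show ?thesis
      using that by (simp add: g_def f_def sum_subtractf)
  qed
  have "g U = 0"
    unfolding g_def using U_ge U_le by (intro sum.neutral) (auto simp: max_def not_le antisym)
  \<comment> \<open>\<open>W\<close> loses at least 1, so it decides some entry against the strict
    sign of \<open>a $ i - \<theta>\<close>. The other tight sets have loss 0 and must decide it the
    other way.\<close>
  have "\<exists>i. \<not> (if i \<in> W then \<theta> \<le> a $ i else a $ i \<le> \<theta>)"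
  proof (rule ccontr)
    assume "\<not> ?thesis"
    then have "g W = 0"
      unfolding g_def by (intro sum.neutral) (auto simp: max_def not_le antisym)
    then show False
      using g[OF card_W] g[OF \<open>card U = k\<close>] \<open>g U = 0\<close> f_W by simp
  qed
  then obtain i where i: "\<not> (if i \<in> W then \<theta> \<le> a $ i else a $ i \<le> \<theta>)" by blast
  have "X \<in> insert W (facet i)" if X: "X \<in> tight_sets k pull a" for X
  proof (cases "X = W")
    case False
    have "card X = k" using X by (simp add: tight_sets_def)
    have "g X = 0"
      using g[OF \<open>card X = k\<close>] g[OF \<open>card U = k\<close>] \<open>g U = 0\<close> f_eq[OF X False] by simp
    moreover have "0 \<le> max 0 (a $ i - \<theta>) - of_bool (i \<in> X) * (a $ i - \<theta>)" for i
      by (simp add: of_bool_def)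
    ultimately have "max 0 (a $ i - \<theta>) - of_bool (i \<in> X) * (a $ i - \<theta>) = 0"
      unfolding g_def by (subst (asm) sum_nonneg_eq_0_iff) auto
    then have "(i \<in> X) \<noteq> (i \<in> W)"
      using i by (auto simp: of_bool_def max_def split: if_splits)
    then show ?thesis using \<open>card X = k\<close> by (simp add: facet_def)
  qed simp
  then show ?thesis by blast
qed blast

section \<open>The maximal cells and the spread\<close>

lemma cell_subset_iff: "cell i \<subseteq> cell j \<longleftrightarrow> i = j"
proof
  assume "cell i \<subseteq> cell j"
  show "i = j"
  proof (rule ccontr)
    assume "i \<noteq> j"
    then obtain X where X: "X \<in> facet i" "X \<notin> facet j" "X \<noteq> W" by (rule facet_separation)
    then have "card X = k" by (simp add: facet_def)
    then have "char_vec X \<in> cell i" "char_vec X \<notin> cell j"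
      unfolding cell_def using X
      by (subst char_vec_in_convex_hull_iff[of _ k]; auto simp: card_insert_W_facet)+
    with \<open>cell i \<subseteq> cell j\<close> show False by blast
  qed
qed simp

lemma maximal_cells_pull: "maximal_cells (subdivision pull) = range cell"
proof -
  have "\<exists>i. C \<subseteq> cell i" if C: "C \<in> subdivision pull" for C
  proof -
    obtain a where "C = convex hull (char_vec ` tight_sets k pull a)"
      using C by (auto simp: regular_subdivision_hypersimplex)
    moreover obtain i where "tight_sets k pull a \<subseteq> insert W (facet i)"
      using tight_sets_subset by blast
    ultimately show ?thesis
      unfolding cell_def by (metis hull_mono image_mono)
  qed
  then have bound: "\<And>C. C \<in> subdivision pull \<Longrightarrow> \<exists>i. C \<subseteq> cell i" by blast
  show ?thesis
  proof (intro equalityI subsetI)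
    fix C assume "C \<in> maximal_cells (subdivision pull)"
    then show "C \<in> range cell"
      using bound cell_in_subdivision unfolding maximal_cells_def by fastforce
  next
    fix C assume "C \<in> range cell"
    then obtain i where i: "C = cell i" by blast
    have "D = C" if "D \<in> subdivision pull" "C \<subseteq> D" for D
    proof -
      obtain j where "D \<subseteq> cell j" using bound[OF \<open>D \<in> subdivision pull\<close>] by blast
      moreover from this have "i = j" using that i cell_subset_iff[of i j] by auto
      ultimately show ?thesis using that i by blast
    qed
    then show "C \<in> maximal_cells (subdivision pull)"
      using i cell_in_subdivision by (simp add: maximal_cells_def)
  qed
qed

lemma inj_cell: "inj cell"
  using cell_subset_iff by (intro injI) blast

lemma spread_pull: "spread (subdivision pull) = CARD('n)"
  by (simp add: spread_def maximal_cells_pull card_image inj_cell)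

text \<open>Exchanging two elements of \<open>W\<close> for two outside, singly and together, gives
  a square with opposite corners \<open>W\<close> and \<open>U\<close>. It yields the functional
  that detects \<open>pull\<close> and the segment that is not an edge of the hypersimplex.\<close>

lemma square:
  obtains P Q U where "card P = k" "card Q = k" "card U = k" "P \<noteq> W" "Q \<noteq> W" "U \<noteq> W"
    "P \<noteq> Q" "P \<noteq> U" "card (U \<inter> W) + 2 = k" "char_vec P + char_vec Q = char_vec W + char_vec U"
proof -
  obtain a b W0 where W: "W = insert a (insert b W0)" "a \<noteq> b" "a \<notin> W0" "b \<notin> W0" "card W0 + 2 = k"
  proof -
    obtain m where "k = Suc (Suc m)" using two_le by (metis One_nat_def Suc_le_D Suc_le_mono numeral_2_eq_2)
    with card_W obtain a W1 where "W = insert a W1" "a \<notin> W1" "card W1 = Suc m"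
      by (metis card_Suc_eq)
    moreover then obtain b W0 where "W1 = insert b W0" "b \<notin> W0" "card W0 = m"
      by (metis card_Suc_eq)
    ultimately show thesis using that \<open>k = Suc (Suc m)\<close> by auto
  qed
  have "1 < card (- W)" using card_W le_card by (simp add: Compl_eq_Diff_UNIV card_Diff_subset)
  then obtain c d where cd: "c \<notin> W" "d \<notin> W" "c \<noteq> d"
    by (metis card_le_Suc0_iff_eq finite not_less One_nat_def ComplD)
  define P where "P = insert c (insert b W0)"
  define Q where "Q = insert a (insert d W0)"
  define U where "U = insert c (insert d W0)"
  note defs = W(1) P_def Q_def U_def
  have cd': "c \<noteq> a" "c \<noteq> b" "c \<notin> W0" "d \<noteq> a" "d \<noteq> b" "d \<notin> W0" using cd W by auto
  have "char_vec P + char_vec Q = char_vec W + char_vec U"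
    using W cd' cd(3) by (auto simp: vec_eq_iff defs)
  moreover have "U \<inter> W = W0"
    using W cd' cd(3) by (auto simp: defs)
  moreover have "card P = k" "card Q = k" "card U = k"
    using W(2-) cd' cd(3) by (auto simp: P_def Q_def U_def)
  moreover have "c \<in> P" "c \<in> U" "d \<in> Q" "d \<in> U" "c \<notin> Q" "d \<notin> P"
    using cd' cd(3) by (auto simp: P_def Q_def U_def)
  then have "P \<noteq> W" "Q \<noteq> W" "U \<noteq> W" "P \<noteq> Q" "P \<noteq> U"
    using cd by blast+
  ultimately show thesis using that W(5) by auto
qed

section \<open>The secondary cone of the pulled subdivision\<close>

lemma subdivision_eq_pullD:
  assumes "(k, CARD('n)) \<noteq> (2, 4)" and eq: "subdivision \<omega> = subdivision pull"
  shows "\<exists>F c. c > 0 \<and> modular_on k F \<and>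
    (\<forall>X. card X = k \<longrightarrow> \<omega> (char_vec X) = c * pull (char_vec X) + F X)"
proof -
  have "\<exists>a. tight_sets k \<omega> a = insert W (facet i)" for i
    using cell_in_subdivision[of i] unfolding cell_def eq[symmetric]
    by (subst (asm) convex_hull_in_regular_subdivision_iff) (auto simp: card_insert_W_facet)
  then obtain a where a: "\<And>i. tight_sets k \<omega> (a i) = insert W (facet i)" by metis
  \<comment> \<open>The affine function of slope \<open>a i\<close> that meets
    \<open>\<omega>\<close> at \<open>W\<close>. It supports \<open>\<omega>\<close> from below and
    agrees with it exactly at the vertices of the \<open>i\<close>-th cell.\<close>
  define f where "f i X = sum (($) (a i)) X - (sum (($) (a i)) W - \<omega> (char_vec W))" for i X
  have f_le: "f i X \<le> \<omega> (char_vec X)" if "card X = k" for i X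
  proof -
    have "W \<in> tight_sets k \<omega> (a i)" using a by simp
    then show ?thesis using that by (simp add: tight_sets_def f_def algebra_simps)
  qed
  have f_eq_iff: "f i X = \<omega> (char_vec X) \<longleftrightarrow> X \<in> insert W (facet i)" if "card X = k" for i X
  proof
    assume "f i X = \<omega> (char_vec X)"
    then have "sum (($) (a i)) X - \<omega> (char_vec X) = sum (($) (a i)) W - \<omega> (char_vec W)"
      by (simp add: f_def)
    moreover have "W \<in> tight_sets k \<omega> (a i)" using a by simp
    ultimately have "X \<in> tight_sets k \<omega> (a i)" using that by (simp add: tight_sets_def)
    then show "X \<in> insert W (facet i)" using a by simp
  next
    assume "X \<in> insert W (facet i)"
    then have "X \<in> tight_sets k \<omega> (a i)" using a by simp
    then have "\<omega> (char_vec X) \<le> f i X"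
      using card_W by (simp add: tight_sets_def f_def algebra_simps)
    then show "f i X = \<omega> (char_vec X)" using f_le[OF that] by (intro antisym)
  qed
  have "modular_on k (f i)" for i
    unfolding f_def by (intro modular_onI[of _ _ "($) (a i)" "- (sum (($) (a i)) W - \<omega> (char_vec W))"]) simp
  moreover have "f i W = f j W" for i j
    using f_eq_iff[of W i] f_eq_iff[of W j] card_W by simp
  moreover have "f i X = f j X"
    if "card X = k" "(i \<in> X) \<noteq> (i \<in> W)" "(j \<in> X) \<noteq> (j \<in> W)" for i j X
    using f_eq_iff[of X i] f_eq_iff[of X j] that by (simp add: facet_def)
  ultimately obtain F c where F: "modular_on k F"
    and f: "\<And>i X. card X = k \<Longrightarrow> f i X = F X + c * of_bool ((i \<in> X) = (i \<in> W))"
    using glue_modular_on[OF card_W two_le le_card assms(1), of f] by blast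
  \<comment> \<open>Every vertex other than \<open>W\<close> lies on some facet avoiding
    \<open>W\<close>, where the correction term vanishes.\<close>
  have \<omega>_F: "\<omega> (char_vec X) = F X" if "card X = k" "X \<noteq> W" for X
  proof -
    obtain i where "(i \<in> X) \<noteq> (i \<in> W)" using \<open>X \<noteq> W\<close> by blast
    then show ?thesis using f_eq_iff[of X i] f[of X i] that by (simp add: facet_def)
  qed
  have \<omega>_W: "\<omega> (char_vec W) = F W + c"
    using f_eq_iff[of W] f[of W] card_W by simp
  \<comment> \<open>At a vertex outside the \<open>j\<close>-th cell, \<open>f j\<close> is strictly
    below \<open>\<omega>\<close>, which equals \<open>F\<close> there, while the factor of
    \<open>c\<close> is 1.\<close>
  have "c < 0"
  proof -
    obtain i j :: 'n where "i \<noteq> j"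
      using le_card by (metis (full_types) UNIV_eq_I card_1_singleton_iff One_nat_def
          add_leD2 not_less_eq_eq numeral_2_eq_2 le_refl singletonI)
    then obtain X where X: "X \<in> facet i" "X \<notin> facet j" "X \<noteq> W" by (rule facet_separation)
    then have "card X = k" by (simp add: facet_def)
    moreover have "f j X \<noteq> \<omega> (char_vec X)" using f_eq_iff[of X j] X \<open>card X = k\<close> by simp
    ultimately have "f j X < \<omega> (char_vec X)" using f_le[of X j] by simp
    moreover have "(j \<in> X) = (j \<in> W)" using X \<open>card X = k\<close> by (simp add: facet_def)
    ultimately show ?thesis
      using \<omega>_F[of X] f[of X j] \<open>card X = k\<close> \<open>X \<noteq> W\<close> by simp
  qed
  have "\<omega> (char_vec X) = (- c) * pull (char_vec X) + F X" if "card X = k" for X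
    using \<omega>_F[OF that] \<omega>_W by (cases "X = W") (simp_all add: pull_def)
  with F \<open>c < 0\<close> show ?thesis by (intro exI[of _ F] exI[of _ "- c"]) auto
qed

text \<open>The functional \<open>\<phi>\<close>, a second difference over the square, vanishes on
  affine functions and is 1 on \<open>pull\<close>. It reads off the coefficient of
  \<open>pull\<close> and so describes the cone by the closed conditions in
  \<open>K\<close>.\<close>

lemma coarsest_pull:
  assumes "(k, CARD('n)) \<noteq> (2, 4)"
  shows "coarsest_subdivision (hypersimplex_vertices k) (subdivision pull)"
proof -
  define L where "L = {l :: real ^ 'n \<Rightarrow> real. modular_on k (\<lambda>X. l (char_vec X))}"
  have L: "secondary_lineality (hypersimplex_vertices k) = L"
    by (simp add: L_def secondary_lineality_hypersimplex)
  obtain P Q U where PQU: "card P = k" "card Q = k" "card U = k" "P \<noteq> W" "Q \<noteq> W" "U \<noteq> W"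
    "char_vec P + char_vec Q = char_vec W + char_vec U"
    by (rule square)
  define \<phi> :: "(real ^ 'n \<Rightarrow> real) \<Rightarrow> real"
    where "\<phi> \<omega> = \<omega> (char_vec P) + \<omega> (char_vec Q) - \<omega> (char_vec W) - \<omega> (char_vec U)" for \<omega>
  have \<phi>_L: "\<phi> l = 0" if "l \<in> L" for l
    using modular_on_parallelogram[of k "\<lambda>X. l (char_vec X)" P Q W U] that PQU card_W
    by (simp add: L_def \<phi>_def)
  have \<phi>_pull: "\<phi> pull = 1"
    using PQU by (simp add: \<phi>_def pull_def)
  define K where "K = {\<omega>. 0 \<le> \<phi> \<omega>} \<inter> {\<omega>. (\<lambda>x. \<omega> x - \<phi> \<omega> * pull x) \<in> L}"
  have cont_\<phi>: "continuous_on UNIV \<phi>"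
    unfolding \<phi>_def by (intro continuous_intros continuous_on_product_coordinates)
  have "closed K"
    unfolding K_def
  proof (rule closed_Int)
    show "closed {\<omega>. 0 \<le> \<phi> \<omega>}"
      using cont_\<phi> by (intro closed_Collect_le continuous_on_const)
    have "continuous_on UNIV (\<lambda>\<omega> x. \<omega> x - \<phi> \<omega> * pull x)"
      by (intro continuous_on_coordinatewise_then_product continuous_intros cont_\<phi>
          continuous_on_product_coordinates)
    moreover have "closed L" unfolding L_def by (rule closed_modular)
    ultimately have "closed ((\<lambda>\<omega> x. \<omega> x - \<phi> \<omega> * pull x) -` L)"
      by (intro closed_vimage)
    then show "closed {\<omega>. (\<lambda>x. \<omega> x - \<phi> \<omega> * pull x) \<in> L}" by (simp add: vimage_def)
  qed
  have cone_eq: "{\<lambda>x. c * pull x + l x | c l. 0 \<le> c \<and> l \<in> L} = K"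
  proof (intro equalityI subsetI)
    fix \<omega> assume "\<omega> \<in> {\<lambda>x. c * pull x + l x | c l. 0 \<le> c \<and> l \<in> L}"
    then obtain c l where \<omega>: "\<omega> = (\<lambda>x. c * pull x + l x)" "0 \<le> c" "l \<in> L" by blast
    then have "\<phi> \<omega> = c * \<phi> pull + \<phi> l" by (simp add: \<phi>_def algebra_simps)
    then have "\<phi> \<omega> = c" using \<phi>_L \<phi>_pull \<omega> by simp
    with \<omega> show "\<omega> \<in> K" by (simp add: K_def)
  next
    fix \<omega> assume "\<omega> \<in> K"
    then show "\<omega> \<in> {\<lambda>x. c * pull x + l x | c l. 0 \<le> c \<and> l \<in> L}"
      unfolding K_def mem_Collect_eq Int_iff
      by (intro exI[of _ "\<phi> \<omega>"] exI[of _ "\<lambda>x. \<omega> x - \<phi> \<omega> * pull x"]) auto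
  qed
  have "secondary_cone (hypersimplex_vertices k) (subdivision pull) = K"
    unfolding secondary_cone_def
  proof
    have "{\<omega>. subdivision \<omega> = subdivision pull} \<subseteq> K"
    proof clarify
      fix \<omega> assume "subdivision \<omega> = subdivision pull"
      then obtain F c where F: "c > 0" "modular_on k F"
        "\<And>X. card X = k \<Longrightarrow> \<omega> (char_vec X) = c * pull (char_vec X) + F X"
        using subdivision_eq_pullD[OF assms] by metis
      define l where "l x = \<omega> x - c * pull x" for x
      have "modular_on k (\<lambda>X. l (char_vec X)) \<longleftrightarrow> modular_on k F"
        using F(3) by (intro modular_on_cong) (simp add: l_def)
      then have "l \<in> L" using F(2) by (simp add: L_def)
      then show "\<omega> \<in> K"
        unfolding cone_eq[symmetric] using \<open>c > 0\<close>
        by (intro CollectI exI[of _ c] exI[of _ l]) (auto simp: l_def)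
    qed
    then show "closure {\<omega>. subdivision \<omega> = subdivision pull} \<subseteq> K"
      using \<open>closed K\<close> by (rule closure_minimal)
    show "K \<subseteq> closure {\<omega>. subdivision \<omega> = subdivision pull}"
      unfolding cone_eq[symmetric]
    proof clarify
      fix c l assume "0 \<le> (c::real)" "l \<in> L"
      show "(\<lambda>x. c * pull x + l x) \<in> closure {\<omega>. subdivision \<omega> = subdivision pull}"
      proof (rule in_closure_along_ray)
        fix e :: real assume "e > 0"
        \<comment> \<open>The coefficient \<open>c + e\<close> is positive even for
          \<open>c = 0\<close>, so the boundary of the cone is reached in the limit.\<close>
        with \<open>0 \<le> c\<close> \<open>l \<in> L\<close>
        have "subdivision (\<lambda>x. c * pull x + l x + e * pull x) = subdivision pull"
          by (intro regular_subdivision_add_modular[of "c + e" k "\<lambda>X. l (char_vec X)"])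
            (auto simp: L_def algebra_simps)
        then show "(\<lambda>x. c * pull x + l x + e * pull x) \<in> {\<omega>. subdivision \<omega> = subdivision pull}"
          by simp
      qed
    qed
  qed
  moreover have "pull \<notin> L" using \<phi>_L \<phi>_pull by force
  ultimately show ?thesis
    unfolding coarsest_subdivision_def L using cone_eq by (intro exI[of _ pull]) simp
qed

text \<open>The segment from \<open>W\<close> to \<open>U\<close> is a cell, but no face of the
  hypersimplex: its midpoint also lies strictly between the vertices \<open>P\<close> and
  \<open>Q\<close>.\<close>

lemma not_Dressian_pull:
  assumes "subdivision \<omega> = subdivision pull"
  shows "\<omega> \<notin> Dressian k"
proof
  obtain P Q U where PQU: "card P = k" "card Q = k" "card U = k" "P \<noteq> W" "U \<noteq> W" "P \<noteq> Q" "P \<noteq> U"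
    "card (U \<inter> W) + 2 = k" "char_vec P + char_vec Q = char_vec W + char_vec U"
    by (rule square)
  define E where "E = convex hull (char_vec ` {W, U})"
  have "\<exists>a. tight_sets k pull a = {W, U}"
  proof
    \<comment> \<open>\<open>W\<close> shares \<open>k - 2\<close> elements with \<open>U\<close>,
      so half of \<open>char_vec U\<close> falls short by exactly 1 at \<open>W\<close>; the lift
      makes up for this.\<close>
    define y where "y X = real (card (U \<inter> X)) / 2 + of_bool (X = W)" for X
    have "sum (($) ((1 / 2) *\<^sub>R char_vec U)) X - pull (char_vec X) = y X" for X
      unfolding inner_char_vec[symmetric] by (simp add: inner_char_vec_char_vec pull_def y_def)
    then have "tight_sets k pull ((1 / 2) *\<^sub>R char_vec U) =
        {X. card X = k \<and> (\<forall>Y. card Y = k \<longrightarrow> y Y \<le> y X)}"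
      by (simp only: tight_sets_def)
    also have "\<dots> = {W, U}"
    proof -
      have y_eq: "y U = k / 2" "y W = k / 2"
        using PQU by (auto simp: y_def field_simps)
      have y_less: "y X < k / 2" if "card X = k" "X \<notin> {W, U}" for X
        using card_Int_less[of X k U] PQU that by (simp add: y_def Int_commute)
      have "y Y \<le> y X" if "X \<in> {W, U}" "card Y = k" for X Y
        using y_less[OF that(2)] y_eq that(1) by (cases "Y \<in> {W, U}") auto
      then have "X \<in> {X. card X = k \<and> (\<forall>Y. card Y = k \<longrightarrow> y Y \<le> y X)}" if "X \<in> {W, U}" for X
        using that PQU(3) card_W by auto
      moreover have "X \<in> {W, U}" if "card X = k" "y U \<le> y X" for X
        using y_less[of X] that y_eq by (cases "X \<in> {W, U}") auto
      ultimately show ?thesis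
        using PQU(3) by (intro equalityI subsetI) auto
    qed
    finally show "tight_sets k pull ((1 / 2) *\<^sub>R char_vec U) = {W, U}" .
  qed
  then have "E \<in> subdivision \<omega>"
    unfolding E_def assms using card_W PQU
    by (subst convex_hull_in_regular_subdivision_iff) auto
  moreover have "aff_dim E = 1"
    using PQU by (simp add: E_def aff_dim_convex_hull aff_dim_2)
  moreover assume "\<omega> \<in> Dressian k"
  ultimately have "E face_of hypersimplex k"
    unfolding Dressian_def vertex_edge_graph_def by blast
  moreover have "midpoint (char_vec P) (char_vec Q) \<in> E"
  proof -
    have "midpoint (char_vec P) (char_vec Q) = midpoint (char_vec W) (char_vec U)"
      using PQU by (simp add: midpoint_def)
    then show ?thesis
      by (simp add: E_def midpoints_in_convex_hull hull_inc)
  qed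
  moreover have "midpoint (char_vec P) (char_vec Q) \<in> open_segment (char_vec P) (char_vec Q)"
    using PQU by simp
  moreover have "char_vec P \<in> hypersimplex k" "char_vec Q \<in> hypersimplex k"
    using PQU by (auto simp: hypersimplex_def intro: hull_inc)
  ultimately have "char_vec P \<in> E" by (meson face_ofD)
  then have "P \<in> {W, U}"
    unfolding E_def using PQU card_W by (subst (asm) char_vec_in_convex_hull_iff[of _ k]) auto
  then show False using PQU by simp
qed

section \<open>The maximal cells as pyramids of lattice height one\<close>

lemma affine_hull_facet_nth:
  assumes "x \<in> affine hull (char_vec ` facet i)"
  shows "x $ i = of_bool (i \<notin> W)"
proof -
  have "affine hull (char_vec ` facet i) \<subseteq> {x. axis i 1 \<bullet> x = of_bool (i \<notin> W)}"
    by (intro hull_minimal affine_hyperplane) (auto simp: facet_def inner_axis' inner_axis)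
  then show ?thesis using assms by (auto simp: inner_axis')
qed

text \<open>Deleting the \<open>i\<close>-th coordinate, which is constantly 0 or 1 on the facet, is
  injective there and preserves integrality both ways. A deleted 0 keeps the size \<open>k\<close>,
  a deleted 1 lowers it.\<close>

lemma lattice_isomorphic_facet:
  assumes "CARD('m::finite) = CARD('n) - 1"
  shows "lattice_isomorphic (convex hull (char_vec ` facet i))
    (hypersimplex (if i \<in> W then k else k - 1) :: (real ^ 'm) set)"
proof -
  define r where "r = (if i \<in> W then k else k - 1)"
  have "card (UNIV :: 'm set) = card (- {i})"
    using assms by (simp add: Compl_eq_Diff_UNIV card_Diff_singleton)
  then obtain \<sigma> :: "'m \<Rightarrow> 'n" where \<sigma>: "bij_betw \<sigma> UNIV (- {i})"
    using finite_same_card_bij[of "UNIV :: 'm set" "- {i}"] by auto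
  then have inj: "inj \<sigma>" and range: "range \<sigma> = - {i}" by (simp_all add: bij_betw_def)
  define g :: "real ^ 'n \<Rightarrow> real ^ 'm" where "g x = (\<chi> j. x $ \<sigma> j)" for x
  have "linear g" by (rule linearI) (simp_all add: g_def vec_eq_iff)
  have g_char_vec: "g (char_vec X) = char_vec (\<sigma> -` X)" for X
    by (simp add: g_def vec_eq_iff)
  have card_vimage: "card (\<sigma> -` X) = card (X - {i})" for X
  proof -
    have "\<sigma> ` (\<sigma> -` X) = X - {i}" using range by (auto simp: image_vimage_eq)
    then show ?thesis using card_image[of \<sigma> "\<sigma> -` X"] inj by (simp add: inj_on_subset)
  qed
  have "vimage \<sigma> ` facet i = {Y :: 'm set. card Y = r}"
  proof (intro equalityI subsetI)
    fix Y assume "Y \<in> vimage \<sigma> ` facet i"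
    then show "Y \<in> {Y :: 'm set. card Y = r}"
      by (auto simp: facet_def card_vimage r_def split: if_splits)
  next
    fix Y assume Y: "Y \<in> {Y :: 'm set. card Y = r}"
    \<comment> \<open>The deleted element is restored exactly on the facets with
      \<open>x_i = 1\<close>.\<close>
    define X where "X = \<sigma> ` Y \<union> (if i \<in> W then {} else {i})"
    have "i \<notin> \<sigma> ` Y" using range by auto
    moreover have "card (\<sigma> ` Y) = r" using Y inj by (simp add: card_image inj_on_subset)
    ultimately have "X \<in> facet i"
      using two_le by (auto simp: facet_def X_def r_def)
    moreover have "\<sigma> -` X = Y"
      using inj range by (auto simp: X_def inj_def split: if_splits)
    ultimately show "Y \<in> vimage \<sigma> ` facet i" by blast
  qed
  then have "g ` char_vec ` facet i = char_vec ` {Y. card Y = r}"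
    by (metis (no_types, lifting) g_char_vec image_cong image_image)
  then have hull: "g ` (convex hull (char_vec ` facet i)) = hypersimplex r"
    by (simp add: hypersimplex_def hypersimplex_vertices_eq convex_hull_linear_image[OF \<open>linear g\<close>])
  define A where "A = affine hull (char_vec ` facet i)"
  have hull_A: "affine hull (convex hull (char_vec ` facet i)) = A"
    by (simp add: A_def affine_hull_convex_hull)
  have A: "g ` A = affine hull (hypersimplex r)"
    unfolding hull[symmetric] hull_A[symmetric]
    using \<open>linear g\<close> by (intro affine_hull_linear_image) (simp add: linear_conv_bounded_linear)
  have nth: "\<exists>j. \<forall>x. x $ l = g x $ j" if "l \<noteq> i" for l
  proof -
    obtain j where "l = \<sigma> j" using range \<open>l \<noteq> i\<close> by blast
    then show ?thesis by (auto simp: g_def)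
  qed
  have "inj_on g A"
  proof (rule inj_onI)
    fix x y assume xy: "x \<in> A" "y \<in> A" "g x = g y"
    have "x $ l = y $ l" for l
    proof (cases "l = i")
      case True
      then show ?thesis using xy affine_hull_facet_nth by (simp add: A_def)
    next
      case False
      then show ?thesis using nth[of l] xy(3) by metis
    qed
    then show "x = y" by (simp add: vec_eq_iff)
  qed
  moreover have "g ` (A \<inter> integer_lattice) = affine hull (hypersimplex r) \<inter> integer_lattice"
  proof (intro equalityI subsetI)
    fix y assume "y \<in> g ` (A \<inter> integer_lattice)"
    then show "y \<in> affine hull (hypersimplex r) \<inter> integer_lattice"
      unfolding A[symmetric] by (auto simp: integer_lattice_def g_def)
  next
    fix y :: "real ^ 'm" assume y: "y \<in> affine hull (hypersimplex r) \<inter> integer_lattice"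
    then obtain x where x: "x \<in> A" "y = g x" unfolding A[symmetric] by blast
    have "x $ l \<in> \<int>" for l
    proof (cases "l = i")
      case True
      then show ?thesis using affine_hull_facet_nth[of x i] x by (simp add: A_def)
    next
      case False
      then show ?thesis using nth[of l] x y by (auto simp: integer_lattice_def)
    qed
    with x show "y \<in> g ` (A \<inter> integer_lattice)" by (auto simp: integer_lattice_def)
  qed
  ultimately show ?thesis
    unfolding lattice_isomorphic_def hull_A r_def[symmetric]
    using \<open>linear g\<close> A hull by (intro exI[of _ g] exI[of _ 0]) (simp add: bij_betw_def)
qed

text \<open>The measuring function is again \<open>x_i\<close> or \<open>1 - x_i\<close>, which has
  integral coefficients.\<close>

lemma lattice_distance_one_facet:
  "lattice_distance_one (char_vec W) (affine hull (char_vec ` facet i))"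
proof -
  define s :: real where "s = (if i \<in> W then 1 else -1)"
  have "axis i s \<bullet> x = s * x $ i" for x :: "real ^ 'n"
    by (simp add: inner_axis')
  moreover have "s \<in> \<int>" by (simp add: s_def)
  ultimately show ?thesis
    unfolding lattice_distance_one_def
    by (intro conjI exI[of _ "axis i s"] exI[of _ "- of_bool (i \<notin> W)"])
      (auto simp: integer_lattice_def affine_hull_facet_nth s_def)
qed

lemma height_one_pyramid_cell:
  assumes "CARD('m::finite) = CARD('n) - 1"
  shows "height_one_pyramid (cell i) (hypersimplex (if i \<in> W then k else k - 1) :: (real ^ 'm) set)"
proof -
  have "cell i = convex hull (insert (char_vec W) (convex hull (char_vec ` facet i)))"
    unfolding cell_def image_insert by (rule hull_insert)
  then show ?thesis
    unfolding height_one_pyramid_def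
    using lattice_isomorphic_facet[OF assms, of i] lattice_distance_one_facet[of i]
    by (intro exI[of _ "convex hull (char_vec ` facet i)"] exI[of _ "char_vec W"])
      (simp add: affine_hull_convex_hull)
qed

end

subsection \<open>The descending lexicographic order\<close>

lemma lex_less_asym: "lex_less x y \<Longrightarrow> \<not> lex_less y x"
  unfolding lex_less_def by (rule less_fun_asym)

lemma card_subsets_with_member:
  assumes "1 \<le> k"
  shows "card {X :: 'a::finite set. card X = k \<and> i \<in> X} = (CARD('a) - 1) choose (k - 1)"
proof -
  have "bij_betw (insert i) {Y. Y \<subseteq> - {i} \<and> card Y = k - 1} {X. card X = k \<and> i \<in> X}"
    using assms
    by (intro bij_betwI[of _ _ _ "\<lambda>X. X - {i}"]) (auto simp: card_insert_if subset_Compl_singleton)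
  then have "card {X. card X = k \<and> i \<in> X} = card {Y. Y \<subseteq> - {i} \<and> card Y = k - 1}"
    by (simp add: bij_betw_same_card)
  also have "\<dots> = card (- {i}) choose (k - 1)" using n_subsets[of "- {i}" "k - 1"] by simp
  finally show ?thesis by (simp add: Compl_eq_Diff_UNIV card_Diff_singleton)
qed

lemma lex_less_if_Min_mem:
  fixes X Y :: "'n::{finite,linorder} set"
  defines "i0 \<equiv> Min (UNIV :: 'n set)"
  assumes "i0 \<in> X" "i0 \<notin> Y"
  shows "lex_less (char_vec Y) (char_vec X)"
proof -
  have "i0 \<le> j" for j unfolding i0_def by (rule Min_le) auto
  then have "\<not> j < i0" for j by (simp add: not_less)
  then show ?thesis
    unfolding lex_less_def less_fun_def using assms(2,3) by (intro exI[of _ i0]) auto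
qed

text \<open>A 1 in the first coordinate outranks a 0, so the indices in \<open>J\<close> form an
  initial interval; counting the \<open>k\<close>-sets through \<open>i0\<close> gives its
  length.\<close>

lemma descending_lex_enumeration:
  fixes v :: "nat \<Rightarrow> real ^ 'n::{finite,linorder}"
  defines "i0 \<equiv> Min (UNIV :: 'n set)"
  assumes "1 \<le> k" and v: "bij_betw v {1..CARD('n) choose k} (hypersimplex_vertices k)"
    and desc: "\<And>i j. \<lbrakk>1 \<le> i; i < j; j \<le> CARD('n) choose k\<rbrakk> \<Longrightarrow> lex_less (v j) (v i)"
    and i: "1 \<le> i" "i \<le> CARD('n) choose k" "v i = char_vec X"
  shows "i \<le> (CARD('n) - 1) choose (k - 1) \<longleftrightarrow> i0 \<in> X"
proof -
  define I where "I = {1..CARD('n) choose k}"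
  define J where "J = {i \<in> I. v i $ i0 = 1}"
  have V: "\<exists>X. v j = char_vec X \<and> card X = k" if "j \<in> I" for j
    using bij_betw_apply[OF v, of j] that by (auto simp: I_def hypersimplex_vertices_eq)
  have "v ` J = char_vec ` {X. card X = k \<and> i0 \<in> X}"
  proof (intro equalityI subsetI)
    fix x assume "x \<in> v ` J"
    then obtain j where "x = v j" "j \<in> I" "v j $ i0 = 1" by (auto simp: J_def)
    with V[of j] show "x \<in> char_vec ` {X. card X = k \<and> i0 \<in> X}" by auto
  next
    fix x assume "x \<in> char_vec ` {X. card X = k \<and> i0 \<in> X}"
    then obtain X where X: "x = char_vec X" "card X = k" "i0 \<in> X" by blast
    then have "x \<in> v ` I" using v by (simp add: bij_betw_def I_def)
    then obtain j where "j \<in> I" "x = v j" by blast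
    moreover from this have "j \<in> J" using X by (simp add: J_def flip: \<open>x = v j\<close>)
    ultimately show "x \<in> v ` J" by blast
  qed
  moreover have "inj_on v J"
    using v by (auto simp: bij_betw_def J_def I_def intro: inj_on_subset)
  moreover have "inj_on char_vec A" for A :: "'n set set" by (simp add: inj_on_def)
  ultimately have card_J: "card J = (CARD('n) - 1) choose (k - 1)"
    using card_subsets_with_member[OF \<open>1 \<le> k\<close>, of i0] by (metis card_image)
  have down: "j' \<in> J" if "j \<in> J" "1 \<le> j'" "j' < j" for j j'
  proof (rule ccontr)
    assume "j' \<notin> J"
    have "j \<in> I" "j' \<in> I" using that by (auto simp: J_def I_def)
    obtain Y Z where YZ: "v j = char_vec Y" "v j' = char_vec Z"
      using V[OF \<open>j \<in> I\<close>] V[OF \<open>j' \<in> I\<close>] by blast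
    have "i0 \<in> Y" "i0 \<notin> Z"
      using \<open>j \<in> J\<close> \<open>j' \<notin> J\<close> \<open>j' \<in> I\<close> YZ by (auto simp: J_def)
    then have "lex_less (v j') (v j)"
      using lex_less_if_Min_mem YZ by (simp add: i0_def)
    moreover have "lex_less (v j) (v j')"
      using desc[of j' j] that \<open>j \<in> I\<close> by (simp add: I_def)
    ultimately show False using lex_less_asym by blast
  qed
  have "finite J" by (simp add: J_def I_def)
  have "J = {1..card J}"
  proof (cases "J = {}")
    case False
    define m where "m = Max J"
    have "m \<in> J" unfolding m_def using \<open>finite J\<close> False by (rule Max_in)
    have "J = {1..m}"
    proof (intro equalityI subsetI)
      fix j assume "j \<in> J"
      then show "j \<in> {1..m}" using \<open>finite J\<close> by (auto simp: m_def J_def I_def)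
    next
      fix j assume "j \<in> {1..m}"
      then show "j \<in> J" using down[OF \<open>m \<in> J\<close>, of j] \<open>m \<in> J\<close> by (cases "j = m") auto
    qed
    then show ?thesis by simp
  qed simp
  then have "i \<in> J \<longleftrightarrow> i \<le> (CARD('n) - 1) choose (k - 1)"
    using i card_J by auto
  moreover have "i \<in> J \<longleftrightarrow> i0 \<in> X"
    using i by (auto simp: J_def I_def)
  ultimately show ?thesis by simp
qed

text \<open>The type \<open>'m\<close> stands for \<open>[n-1]\<close>. For \<open>(2, 4)\<close>,
  pulling a vertex of the octahedron gives four tetrahedra around a diagonal; they refine the split
  along a square through that diagonal, so this case is excluded from coarseness.\<close>

theorem theorem4p11:
  fixes k :: nat
    and v :: "nat \<Rightarrow> real ^ 'n::{finite,linorder}"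
    and \<kappa> :: "real ^ 'n::{finite,linorder} \<Rightarrow> real"
  assumes "2 \<le> k" and "k + 2 \<le> CARD('n)"
    and "bij_betw v {1..CARD('n) choose k} (hypersimplex_vertices k)"
    and "\<And>i j. \<lbrakk>1 \<le> i; i < j; j \<le> CARD('n) choose k\<rbrakk> \<Longrightarrow> lex_less (v j) (v i)"
    and "\<And>i. \<lbrakk>1 \<le> i; i \<le> CARD('n) choose k\<rbrakk> \<Longrightarrow>
           \<kappa> (v i) = (if i \<le> ((CARD('n) - 1) choose (k - 1)) - 1 then 1 else 0)"
    and "CARD('m::finite) = CARD('n) - 1"
  shows "\<kappa> \<notin> Dressian k
    \<and> ((k, CARD('n)) \<noteq> (2, 4) \<longrightarrow>
         coarsest_subdivision (hypersimplex_vertices k)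
           (regular_subdivision (hypersimplex_vertices k) \<kappa>))
    \<and> spread (regular_subdivision (hypersimplex_vertices k) \<kappa>) = CARD('n)
    \<and> (\<exists>A \<subseteq> maximal_cells (regular_subdivision (hypersimplex_vertices k) \<kappa>).
         card A = k \<and>
         (\<forall>P\<in>A. height_one_pyramid P (hypersimplex k :: (real ^ 'm) set)) \<and>
         (\<forall>P\<in>maximal_cells (regular_subdivision (hypersimplex_vertices k) \<kappa>) - A.
            height_one_pyramid P (hypersimplex (k - 1) :: (real ^ 'm) set)))"
proof -
  define N where "N = (CARD('n) - 1) choose (k - 1)"
  define i0 where "i0 = Min (UNIV :: 'n set)"
  \<comment> \<open>Hence \<open>v N\<close> is a vertex, and the truncated difference
    \<open>N - 1\<close> is the index just before it.\<close>
  have "1 \<le> N" using assms(1,2) by (simp add: N_def Suc_le_eq zero_less_binomial_iff)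
  have "CARD('n) choose k = N + (CARD('n) - 1 choose k)"
    using assms(1,2) by (simp add: N_def choose_reduce_nat)
  then have N: "1 \<le> N" "N \<le> CARD('n) choose k" using \<open>1 \<le> N\<close> by simp_all
  \<comment> \<open>\<open>N\<close> is the last index with first coordinate 1, and
    \<open>\<kappa>\<close> is already 0 there. So \<open>\<kappa>\<close> is the first coordinate
    minus the indicator of \<open>v N\<close>.\<close>
  obtain W where W: "v N = char_vec W" "card W = k"
    using bij_betw_apply[OF assms(3), of N] N by (auto simp: hypersimplex_vertices_eq)
  interpret pulled_hypersimplex k W
    by unfold_locales (use W assms(1,2) in auto)
  have "\<kappa> (char_vec X) = 1 * pull (char_vec X) + of_bool (i0 \<in> X)" if "card X = k" for X
  proof -
    have "char_vec X \<in> v ` {1..CARD('n) choose k}"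
      using assms(3) that by (simp add: bij_betw_def)
    then obtain i where i: "1 \<le> i" "i \<le> CARD('n) choose k" "v i = char_vec X" by auto
    have "i \<le> N \<longleftrightarrow> i0 \<in> X"
      unfolding N_def i0_def
      using assms(1) i by (intro descending_lex_enumeration[OF _ assms(3,4)]) auto
    moreover have "X = W \<longleftrightarrow> i = N"
      using inj_on_eq_iff[OF bij_betw_imp_inj_on[OF assms(3)], of i N] i N W(1) by auto
    ultimately show ?thesis
      using assms(5)[OF i(1,2)] i(3) \<open>1 \<le> N\<close> unfolding N_def[symmetric] pull_def
      by (auto simp: of_bool_def)
  qed
  then have eq: "subdivision \<kappa> = subdivision pull"
    by (intro regular_subdivision_add_modular[of 1 k "\<lambda>X. of_bool (i0 \<in> X)"]
        modular_on_mem[of k i0]) auto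
  \<comment> \<open>The cells with \<open>i \<in> W\<close> have their bases on
    \<open>x_i = 0\<close>, so these are the pyramids over the hypersimplex with the same
    \<open>k\<close>.\<close>
  have "card (cell ` W) = k"
    using W(2) inj_cell by (simp add: card_image inj_on_subset)
  moreover have "\<forall>P\<in>cell ` W. height_one_pyramid P (hypersimplex k :: (real ^ 'm) set)"
  proof
    fix P assume "P \<in> cell ` W"
    then obtain i where "P = cell i" "i \<in> W" by blast
    then show "height_one_pyramid P (hypersimplex k :: (real ^ 'm) set)"
      using height_one_pyramid_cell[OF assms(6), of i] by simp
  qed
  moreover have "\<forall>P\<in>range cell - cell ` W.
      height_one_pyramid P (hypersimplex (k - 1) :: (real ^ 'm) set)"
  proof
    fix P assume "P \<in> range cell - cell ` W"
    then obtain i where "P = cell i" "i \<notin> W" by blast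
    then show "height_one_pyramid P (hypersimplex (k - 1) :: (real ^ 'm) set)"
      using height_one_pyramid_cell[OF assms(6), of i] by simp
  qed
  ultimately have pyramids: "\<exists>A \<subseteq> maximal_cells (subdivision \<kappa>). card A = k \<and>
         (\<forall>P\<in>A. height_one_pyramid P (hypersimplex k :: (real ^ 'm) set)) \<and>
         (\<forall>P\<in>maximal_cells (subdivision \<kappa>) - A.
            height_one_pyramid P (hypersimplex (k - 1) :: (real ^ 'm) set))"
    unfolding eq maximal_cells_pull by (intro exI[of _ "cell ` W"] conjI) auto
  show ?thesis
  proof (intro conjI impI)
    show "\<kappa> \<notin> Dressian k" by (rule not_Dressian_pull[OF eq])
    show "coarsest_subdivision (hypersimplex_vertices k) (subdivision \<kappa>)"
      if "(k, CARD('n)) \<noteq> (2, 4)"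
      unfolding eq using that by (rule coarsest_pull)
    show "spread (subdivision \<kappa>) = CARD('n)"
      unfolding eq by (rule spread_pull)
  qed (rule pyramids)
qed

end
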